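(* Let $\mathcal{R}^{AS}$ be the region of asymptotic stability of the randomized two-stage Runge-Kutta method. Then: (i) The set $\mathcal{R}^{AS}$ is open and symmetric with respect to the real axis. (ii) $\mathcal{I}^{Mid}\subset[-2,0)\subset\mathcal{I}^{AS}\subset(-\sqrt{2e},0)$. (iii) There exists $r_0\in(0,\infty)$ such that $\mathcal{R}^{AS}\subset\mathbb{C}_{-}\cap\{z\in\mathbb{C}:|z|<r_0\}$.
   Context: $\mathbb{C}_{-}=\{z\in\mathbb{C}:\Re(z)<0\}$. Let $(\tau_j)_{j\in\mathbb{N}}$ be i.i.d. random variables uniformly distributed on $[0,1]$ on a complete probability space $(\Omega,\Sigma,\mathbb{P})$. For $z\in\mathbb{C}$ put $p_j(z)=\tau_jz^2+z+1$. Fix $\eta\ne0$. Applying the randomized two-stage Runge-Kutta method with step-size $h>0$ to the test problem $z'(t)=\lambda z(t)$, $t\ge0$, $z(0)=\eta$ ($\lambda\in\mathbb{C}$), and substituting $z=h\lambda$, gives $V^0=\eta$ and $V^k=V^k(z)=\eta\prod_{j=1}^kp_j(z)$, $k\in\mathbb{N}$. Define $\mathcal{R}^{AS}=\{z\in\mathbb{C}:V^k\to0\text{ almost surely as }k\to\infty\}$, $\mathcal{R}^{Mid}=\{z\in\mathbb{C}:|\tfrac12z^2+z+1|^2<1\}$, $\mathcal{I}^{AS}=\mathcal{R}^{AS}\cap\{z\in\mathbb{C}:\Im(z)=0\}$ and $\mathcal{I}^{Mid}=\mathcal{R}^{Mid}\cap\{z\in\mathbb{C}:\Im(z)=0\}$;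 the latter two are identified with subsets of $\mathbb{R}$. *)

theory Defs
  imports "HOL-Probability.Probability"
begin

definition rk_factor :: "real \<Rightarrow> complex \<Rightarrow> complex" where
  "rk_factor t z = complex_of_real t * z\<^sup>2 + z + 1"

text \<open>The approximation after \<open>k\<close> steps with \<open>z = h \<lambda>\<close>. The random nodes are
  indexed from 1, so \<open>\<tau> 0\<close> is never used.\<close>

definition rk_step :: "complex \<Rightarrow> (nat \<Rightarrow> 'a \<Rightarrow> real) \<Rightarrow> complex \<Rightarrow> nat \<Rightarrow> 'a \<Rightarrow> complex" where
  "rk_step \<eta> \<tau> z k \<omega> = \<eta> * (\<Prod>j=1..k. rk_factor (\<tau> j \<omega>) z)"

definition region_AS :: "'a measure \<Rightarrow> complex \<Rightarrow> (nat \<Rightarrow> 'a \<Rightarrow> real) \<Rightarrow> complex set" where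
  "region_AS M \<eta> \<tau> = {z. AE \<omega> in M. (\<lambda>k. rk_step \<eta> \<tau> z k \<omega>) \<longlonglongrightarrow> 0}"

definition region_Mid :: "complex set" where
  "region_Mid = {z. (cmod (1 / 2 * z\<^sup>2 + z + 1))\<^sup>2 < 1}"

text \<open>The stability intervals are kept as subsets of the complex plane; real intervals are
  compared with them through their image under \<^const>\<open>complex_of_real\<close>.\<close>

definition interval_AS :: "'a measure \<Rightarrow> complex \<Rightarrow> (nat \<Rightarrow> 'a \<Rightarrow> real) \<Rightarrow> complex set" where
  "interval_AS M \<eta> \<tau> = region_AS M \<eta> \<tau> \<inter> {z. Im z = 0}"

definition interval_Mid :: "complex set" where
  "interval_Mid = region_Mid \<inter> {z. Im z = 0}"

end

theory Submission
  imports Defs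
begin

text \<open>
  Everything is governed by the mean logarithmic growth factor
  \<open>f z = \<integral> ln \<bar>t z\<^sup>2 + z + 1\<bar> dt\<close> over \<open>[0, 1]\<close>: the logarithm of \<open>\<bar>V\<^sup>k / \<eta>\<bar>\<close> is a
  random walk with independent identically distributed steps of mean \<open>f z\<close>, and
  \<open>region_AS_eq_mean_log_factor_neg\<close> shows that the region of asymptotic stability is exactly
  \<open>{z. f z < 0}\<close>.

  If \<open>f z < 0\<close>, then some moment \<open>E \<bar>p z\<bar>\<^sup>s\<close> with \<open>s > 0\<close> is smaller than \<open>1\<close>, because
  \<open>(x\<^sup>s - 1) / s\<close> decreases to \<open>ln x\<close> as \<open>s\<close> decreases to \<open>0\<close>. Independence makes the \<open>s\<close>-th
  moments of \<open>V\<^sup>k\<close> decay geometrically; they are summable, which forces \<open>V\<^sup>k\<close> to \<open>0\<close> almost surely.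
  If \<open>f z \<ge> 0\<close> and \<open>z \<noteq> 0\<close>, the steps are not constant and have finite variance, so by the
  central limit theorem the walk is positive with a probability that stays away from \<open>0\<close>. This
  excludes \<open>V\<^sup>k \<longlonglongrightarrow> 0\<close>, also in the critical case \<open>f z = 0\<close>, for which a law of large
  numbers would say nothing. At \<open>z = 0\<close> the sequence is constant.

  Openness comes for free from the moments (\<open>mean_log_factor_neg_iff_moment\<close>): \<open>{z. f z < 0}\<close> is
  the union over \<open>s > 0\<close> of the sets on which the \<open>s\<close>-th moment, a continuous function of \<open>z\<close>,
  is below \<open>1\<close>; the logarithmic singularities of \<open>f\<close> never have to be controlled uniformly.

  The geometric claims reduce to sign statements about \<open>f\<close>. For \<open>z \<noteq> 0\<close> there is \<open>c \<in> [0, 1]\<close>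
  with \<open>\<bar>t z\<^sup>2 + z + 1\<bar> \<ge> \<bar>z\<bar>\<^sup>2 \<bar>t - c\<bar>\<close>, and the integral of \<open>ln \<bar>t - c\<bar>\<close> is at least
  \<open>- ln (2 e)\<close>; hence \<open>f z \<ge> 0\<close> once \<open>\<bar>z\<bar>\<^sup>2 \<ge> 2 e\<close>, which gives both the radius of a bounding disc
  and the left end of the real interval. For \<open>Re z \<ge> 0\<close>, pairing \<open>t\<close> with \<open>1 - t\<close> gives
  \<open>\<bar>p\<^sub>t z\<bar> \<bar>p\<^bsub>1-t\<^esub> z\<bar> \<ge> 1\<close> and so \<open>f z \<ge> 0\<close>. On \<open>[-1, 0)\<close> the estimate \<open>ln p \<le> p - 1\<close> shows
  \<open>f < 0\<close>, and on \<open>[-2, -1)\<close> the integral is evaluated explicitly.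
\<close>

section \<open>The uniform distribution on the unit interval\<close>

abbreviation (input) unif01 :: "real measure" where
  "unif01 \<equiv> uniform_measure lborel {0..1}"

lemma unif01_eq_density: "unif01 = density lborel (\<lambda>t. ennreal (indicator {0..1} t))"
  unfolding uniform_measure_def by (intro density_cong) (auto split: split_indicator)

lemma prob_space_unif01: "prob_space unif01"
  by (rule prob_space_uniform_measure) auto

interpretation unif01: prob_space unif01 by (rule prob_space_unif01)

lemma integral_unif01:
  fixes g :: "real \<Rightarrow> real"
  assumes [measurable]: "g \<in> borel_measurable borel"
  shows "integral\<^sup>L unif01 g = (\<integral>t. indicator {0..1} t * g t \<partial>lborel)"
  unfolding unif01_eq_density by (subst integral_density) auto

lemma AE_unif01_iff: "(AE t in unif01. P t) \<longleftrightarrow> (AE t in lborel. t \<in> {0..1} \<longrightarrow> P t)"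
  by (rule AE_uniform_measure) auto

lemma AE_unif01_unit_interval: "AE t in unif01. t \<in> {0..1}"
  by (simp add: AE_unif01_iff)

lemma AE_unif01_notin_finite:
  assumes "finite S"
  shows "AE t in unif01. t \<notin> S"
proof -
  have "S \<in> null_sets lborel"
    using assms by (intro finite_imp_null_set_lborel)
  from AE_not_in[OF this] show ?thesis
    unfolding AE_unif01_iff by eventually_elim simp
qed

lemma AE_unif01_neq: "AE t in unif01. t \<noteq> c"
  using AE_unif01_notin_finite[of "{c}"] by simp

text \<open>Integrals over the unit interval are computed by the fundamental theorem of calculus in its
  gauge-integral form, which tolerates an interior singularity of the integrand. For integrands
  of one sign the result transfers to Lebesgue integrability, which need not be known before.\<close>

lemma has_integral_imp_integral_unif01:
  fixes g :: "real \<Rightarrow> real"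
  assumes [measurable]: "g \<in> borel_measurable borel"
    and nonneg: "\<And>t. t \<in> {0..1} \<Longrightarrow> 0 \<le> g t"
    and I: "(g has_integral I) {0..1}"
  shows "integrable unif01 g" "integral\<^sup>L unif01 g = I"
proof -
  let ?g = "\<lambda>t. indicator {0..1} t * g t"
  have "(?g has_integral I) {0..1}"
    using I by (rule has_integral_eq[rotated]) auto
  then have "(?g has_integral I) UNIV"
    by (rule has_integral_on_superset) auto
  then have "integral\<^sup>N lborel ?g = I"
    using nonneg by (intro nn_integral_has_integral_lborel) (auto split: split_indicator)
  moreover have "integral\<^sup>N unif01 g = integral\<^sup>N lborel ?g"
    unfolding unif01_eq_density
    by (subst nn_integral_density) (auto intro!: nn_integral_cong split: split_indicator)
  moreover have "0 \<le> I"
    using I nonneg by (rule has_integral_nonneg)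
  moreover have "AE t in unif01. 0 \<le> g t"
    using AE_unif01_unit_interval by eventually_elim (rule nonneg)
  ultimately have "integrable unif01 g \<and> integral\<^sup>L unif01 g = I"
    by (subst nn_integral_eq_integrable[symmetric]) auto
  then show "integrable unif01 g" "integral\<^sup>L unif01 g = I"
    by auto
qed

lemma integral_unif01_reflect:
  fixes g :: "real \<Rightarrow> real"
  assumes [measurable]: "g \<in> borel_measurable borel"
  shows "(\<integral>t. g (1 - t) \<partial>unif01) = integral\<^sup>L unif01 g"
proof -
  have "integral\<^sup>L unif01 g = (\<integral>t. indicator {0..1} t * g t \<partial>lborel)"
    by (rule integral_unif01) simp
  also have "\<dots> = (\<integral>t. indicator {0..1} (1 - t) * g (1 - t) \<partial>lborel)"
    by (subst lborel_integral_real_affine[where c = "-1" and t = 1]) auto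
  also have "\<dots> = (\<integral>t. indicator {0..1} t * g (1 - t) \<partial>lborel)"
    by (intro Bochner_Integration.integral_cong) (auto split: split_indicator)
  also have "\<dots> = (\<integral>t. g (1 - t) \<partial>unif01)"
    by (rule integral_unif01[symmetric]) simp
  finally show ?thesis ..
qed

lemma integrable_unif01_reflect:
  fixes g :: "real \<Rightarrow> real"
  assumes [measurable]: "g \<in> borel_measurable borel" and "integrable unif01 g"
  shows "integrable unif01 (\<lambda>t. g (1 - t))"
proof -
  have "integrable lborel (\<lambda>t. indicator {0..1} t * g t)"
    using assms(2) unfolding unif01_eq_density by (subst (asm) integrable_density) auto
  from lborel_integrable_real_affine[OF this, of "-1" 1]
  have "integrable lborel (\<lambda>t. indicator {0..1} (1 - t) * g (1 - t))"
    by simp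
  then have "integrable lborel (\<lambda>t. indicator {0..1} t * g (1 - t))"
    by (rule Bochner_Integration.integrable_cong[THEN iffD1, rotated -1])
       (auto split: split_indicator)
  then show ?thesis
    unfolding unif01_eq_density by (subst integrable_density) auto
qed

section \<open>Logarithmic singularities in the unit interval\<close>

text \<open>The primitive of \<open>ln \<bar>t - c\<bar>\<close> contains this function; its continuity at \<open>0\<close> is what lets the
  fundamental theorem of calculus pass through the singularity at \<open>c\<close>.\<close>

lemma isCont_mult_ln_abs: "isCont (\<lambda>u::real. u * ln \<bar>u\<bar>) x"
proof (cases "x = 0")
  case True
  have bound: "\<bar>u * ln \<bar>u\<bar>\<bar> \<le> 2 * sqrt \<bar>u\<bar>" if "\<bar>u\<bar> < 1" for u :: real
  proof (cases "u = 0")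
    case False
    then have pos: "\<bar>u\<bar> > 0" "sqrt \<bar>u\<bar> > 0" by auto
    \<comment> \<open>Applying \<open>ln y \<le> y - 1\<close> to a root of \<open>1 / \<bar>u\<bar>\<close> trades the logarithm for a smaller power.\<close>
    have "ln (1 / sqrt \<bar>u\<bar>) \<le> 1 / sqrt \<bar>u\<bar> - 1"
      using pos by (intro ln_le_minus_one) auto
    moreover have "ln (1 / sqrt \<bar>u\<bar>) = - ln \<bar>u\<bar> / 2"
      using pos by (simp add: ln_div ln_sqrt)
    ultimately have "- ln \<bar>u\<bar> \<le> 2 / sqrt \<bar>u\<bar>"
      by simp
    moreover have "ln \<bar>u\<bar> \<le> 0"
      using that pos by simp
    ultimately have "\<bar>ln \<bar>u\<bar>\<bar> \<le> 2 / sqrt \<bar>u\<bar>" by simp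
    then have "\<bar>u\<bar> * \<bar>ln \<bar>u\<bar>\<bar> \<le> \<bar>u\<bar> * (2 / sqrt \<bar>u\<bar>)"
      by (intro mult_left_mono) auto
    also have "\<dots> = 2 * sqrt \<bar>u\<bar>"
      using pos by (simp add: field_simps)
    finally show ?thesis by (simp add: abs_mult)
  qed simp
  have "((\<lambda>u::real. u * ln \<bar>u\<bar>) \<longlongrightarrow> 0) (at 0)"
  proof (rule tendsto_rabs_zero_cancel, rule tendsto_sandwich[of "\<lambda>_. 0"])
    show "\<forall>\<^sub>F u::real in at 0. \<bar>u * ln \<bar>u\<bar>\<bar> \<le> 2 * sqrt \<bar>u\<bar>"
      unfolding eventually_at by (intro exI[of _ 1]) (auto intro!: bound)
    have "((\<lambda>u::real. 2 * sqrt \<bar>u\<bar>) \<longlongrightarrow> 2 * sqrt \<bar>0\<bar>) (at 0)"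
      by (intro tendsto_intros)
    then show "((\<lambda>u::real. 2 * sqrt \<bar>u\<bar>) \<longlongrightarrow> 0) (at 0)" by simp
  qed auto
  then show ?thesis
    using True by (simp add: isCont_def)
next
  case False
  then show ?thesis by (intro continuous_intros) auto
qed

lemma integral_unif01_ln_dist:
  assumes c: "0 \<le> c" "c \<le> 1"
  shows "integrable unif01 (\<lambda>t. ln \<bar>t - c\<bar>)"
    and "(\<integral>t. ln \<bar>t - c\<bar> \<partial>unif01) = c * ln c + (1 - c) * ln (1 - c) - 1"
proof -
  let ?F = "\<lambda>t. t - (t - c) * ln \<bar>t - c\<bar>"
  have "((\<lambda>t. - ln \<bar>t - c\<bar>) has_integral (?F 1 - ?F 0)) {0..1}"
  proof (rule fundamental_theorem_of_calculus_interior_strong[of "{c}"])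
    fix t assume "t \<in> {0<..<1} - {c}"
    then consider "t < c" | "t > c" by fastforce
    then have "(?F has_real_derivative - ln \<bar>t - c\<bar>) (at t)"
    proof cases
      case 1
      have "((\<lambda>t. t - (t - c) * ln (c - t)) has_real_derivative - ln \<bar>t - c\<bar>) (at t)"
        using 1 by (auto intro!: derivative_eq_intros simp: divide_simps)
      moreover have "\<forall>\<^sub>F s in nhds t. s \<in> {..<c}"
        using 1 by (intro eventually_nhds_in_open) auto
      then have "\<forall>\<^sub>F s in nhds t. ?F s = s - (s - c) * ln (c - s)"
        by eventually_elim auto
      ultimately show ?thesis
        by (subst DERIV_cong_ev) auto
    next
      case 2
      have "((\<lambda>t. t - (t - c) * ln (t - c)) has_real_derivative - ln \<bar>t - c\<bar>) (at t)"
        using 2 by (auto intro!: derivative_eq_intros simp: divide_simps)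
      moreover have "\<forall>\<^sub>F s in nhds t. s \<in> {c<..}"
        using 2 by (intro eventually_nhds_in_open) auto
      then have "\<forall>\<^sub>F s in nhds t. ?F s = s - (s - c) * ln (s - c)"
        by eventually_elim auto
      ultimately show ?thesis
        by (subst DERIV_cong_ev) auto
    qed
    then show "(?F has_vector_derivative - ln \<bar>t - c\<bar>) (at t)"
      by (simp add: has_real_derivative_iff_has_vector_derivative)
  next
    have "isCont (\<lambda>t. (t - c) * ln \<bar>t - c\<bar>) t" for t
      by (rule isCont_o2[where f = "\<lambda>t. t - c" and g = "\<lambda>u. u * ln \<bar>u\<bar>"])
         (auto intro: isCont_mult_ln_abs)
    then show "continuous_on {0..1} ?F"
      by (intro continuous_on_diff continuous_on_id) (simp add: continuous_at_imp_continuous_on)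
  qed auto
  moreover have "?F 1 - ?F 0 = - (c * ln c + (1 - c) * ln (1 - c) - 1)"
    using c by simp
  ultimately have I: "((\<lambda>t. - ln \<bar>t - c\<bar>) has_integral
      - (c * ln c + (1 - c) * ln (1 - c) - 1)) {0..1}"
    by metis
  \<comment> \<open>Both \<open>t\<close> and \<open>c\<close> lie in the unit interval, so the logarithm has a sign; at \<open>t = c\<close> this
    uses the convention \<open>ln 0 = 0\<close>.\<close>
  have nonneg: "0 \<le> - ln \<bar>t - c\<bar>" if "t \<in> {0..1}" for t
    using c that by (cases "t = c") auto
  have "integrable unif01 (\<lambda>t. - ln \<bar>t - c\<bar>)"
    "(\<integral>t. - ln \<bar>t - c\<bar> \<partial>unif01) = - (c * ln c + (1 - c) * ln (1 - c) - 1)"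
    by (rule has_integral_imp_integral_unif01[OF _ nonneg I]; simp)+
  then show "integrable unif01 (\<lambda>t. ln \<bar>t - c\<bar>)"
    "(\<integral>t. ln \<bar>t - c\<bar> \<partial>unif01) = c * ln c + (1 - c) * ln (1 - c) - 1"
    by simp_all
qed

lemma integrable_unif01_inverse_sqrt_dist: "integrable unif01 (\<lambda>t. 1 / sqrt \<bar>t - c\<bar>)"
proof -
  \<comment> \<open>As \<^const>\<open>sqrt\<close> is odd, \<open>2 * sqrt (t - c)\<close> is a primitive on both sides of \<open>c\<close>.\<close>
  have "((\<lambda>t. 1 / sqrt \<bar>t - c\<bar>) has_integral (2 * sqrt (1 - c) - 2 * sqrt (0 - c))) {0..1}"
  proof (rule fundamental_theorem_of_calculus_interior_strong[of "{c}"])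
    fix t assume "t \<in> {0<..<1} - {c}"
    then consider "t < c" | "t > c" by fastforce
    then have "((\<lambda>t. 2 * sqrt (t - c)) has_real_derivative 1 / sqrt \<bar>t - c\<bar>) (at t)"
    proof cases
      case 1
      have "((\<lambda>t. - (2 * sqrt (c - t))) has_real_derivative 1 / sqrt \<bar>t - c\<bar>) (at t)"
        using 1 by (auto intro!: derivative_eq_intros simp: divide_simps)
      then show ?thesis
        using real_sqrt_minus[of "c - _"] by simp
    next
      case 2
      then show ?thesis
        by (auto intro!: derivative_eq_intros simp: divide_simps)
    qed
    then show "((\<lambda>t. 2 * sqrt (t - c)) has_vector_derivative 1 / sqrt \<bar>t - c\<bar>) (at t)"
      by (simp add: has_real_derivative_iff_has_vector_derivative)
  qed (auto intro!: continuous_intros)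
  then show ?thesis
    by (rule has_integral_imp_integral_unif01(1)[rotated 2]) auto
qed

text \<open>For \<open>0 < y \<le> 1\<close> the value \<open>- ln y\<close> is nonnegative and at most \<open>4\<close> times the fourth root of
  \<open>1 / y\<close>, so its square is dominated by the integrable singularity \<open>16 / sqrt y\<close>.\<close>

lemma integrable_unif01_ln_dist_square:
  assumes c: "0 \<le> c" "c \<le> 1"
  shows "integrable unif01 (\<lambda>t. (ln \<bar>t - c\<bar>)\<^sup>2)"
proof (rule Bochner_Integration.integrable_bound)
  show "integrable unif01 (\<lambda>t. 16 * (1 / sqrt \<bar>t - c\<bar>))"
    by (intro integrable_mult_right integrable_unif01_inverse_sqrt_dist)
  have bound: "(ln \<bar>t - c\<bar>)\<^sup>2 \<le> 16 * (1 / sqrt \<bar>t - c\<bar>)" if "t \<in> {0..1}" for t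
  proof (cases "t = c")
    case False
    \<comment> \<open>\<open>u\<close> is the fourth root of the distance.\<close>
    define u where "u = sqrt (sqrt \<bar>t - c\<bar>)"
    have u: "u > 0" "u\<^sup>2 = sqrt \<bar>t - c\<bar>"
      using False by (auto simp: u_def)
    have u4: "\<bar>t - c\<bar> = u ^ 4"
    proof -
      have "u ^ 4 = (u\<^sup>2)\<^sup>2" by simp
      then show ?thesis by (simp only: u(2)) simp
    qed
    have "ln (1 / u) \<le> 1 / u - 1"
      using u by (intro ln_le_minus_one) auto
    moreover have "ln (1 / u) = - ln u"
      using u by (simp add: ln_div)
    ultimately have "- ln \<bar>t - c\<bar> \<le> 4 / u"
      unfolding u4 using u by (simp add: ln_realpow)
    moreover have "\<bar>t - c\<bar> \<le> 1"
      using c that by (auto simp: abs_le_iff)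
    then have "ln \<bar>t - c\<bar> \<le> 0"
      using False by simp
    ultimately have "\<bar>ln \<bar>t - c\<bar>\<bar> \<le> \<bar>4 / u\<bar>"
      using u by simp
    then have "(ln \<bar>t - c\<bar>)\<^sup>2 \<le> (4 / u)\<^sup>2"
      by (simp only: abs_le_square_iff)
    also have "\<dots> = 16 * (1 / sqrt \<bar>t - c\<bar>)"
      using u by (simp add: power_divide)
    finally show ?thesis .
  qed simp
  show "AE t in unif01. norm ((ln \<bar>t - c\<bar>)\<^sup>2) \<le> norm (16 * (1 / sqrt \<bar>t - c\<bar>))"
    using AE_unif01_unit_interval
  proof eventually_elim
    case (elim t)
    then show ?case using bound[of t] by simp
  qed
qed simp

section \<open>The random factor\<close>

lemma measurable_rk_factor [measurable]: "(\<lambda>t. rk_factor t z) \<in> borel_measurable borel"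
  unfolding rk_factor_def by measurable

lemma rk_factor_0 [simp]: "rk_factor t 0 = 1"
  by (simp add: rk_factor_def)

lemma rk_factor_of_real: "rk_factor t (of_real x) = of_real (t * x\<^sup>2 + x + 1)"
  by (simp add: rk_factor_def)

lemma rk_factor_cnj: "rk_factor t (cnj z) = cnj (rk_factor t z)"
  by (simp add: rk_factor_def)

lemma cmod_rk_factor_le:
  assumes "t \<in> {0..1}"
  shows "cmod (rk_factor t z) \<le> (cmod z)\<^sup>2 + cmod z + 1"
proof -
  have "cmod (rk_factor t z) \<le> cmod (of_real t * z\<^sup>2) + cmod z + cmod 1"
    unfolding rk_factor_def by (intro order_trans[OF norm_triangle_ineq] add_mono norm_triangle_ineq order_refl)
  also have "cmod (of_real t * z\<^sup>2) \<le> 1 * (cmod z)\<^sup>2"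
    unfolding norm_mult norm_power using assms by (intro mult_right_mono) auto
  finally show ?thesis by simp
qed

text \<open>Divided by \<open>z\<^sup>2\<close>, the factor becomes \<open>t - w\<close> for a complex number \<open>w\<close>. Passing to the real part of
  \<open>w\<close> and then to its nearest point in \<open>[0, 1]\<close> only decreases the distance to \<open>t\<close>. Placing \<open>c\<close> in the
  unit interval reduces every singularity of \<open>ln \<bar>p\<bar>\<close> to the case treated above.\<close>

lemma cmod_rk_factor_ge_dist:
  assumes "z \<noteq> 0"
  obtains c where "0 \<le> c" "c \<le> 1"
    "\<And>t. t \<in> {0..1} \<Longrightarrow> (cmod z)\<^sup>2 * \<bar>t - c\<bar> \<le> cmod (rk_factor t z)"
proof -
  define w where "w = - (z + 1) / z\<^sup>2"
  define c where "c = max 0 (min 1 (Re w))"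
  have "(cmod z)\<^sup>2 * \<bar>t - c\<bar> \<le> cmod (rk_factor t z)" if "t \<in> {0..1}" for t
  proof -
    have "\<bar>t - c\<bar> \<le> \<bar>t - Re w\<bar>"
      using that by (auto simp: c_def)
    also have "\<dots> \<le> cmod (of_real t - w)"
      using abs_Re_le_cmod[of "of_real t - w"] by simp
    finally have "(cmod z)\<^sup>2 * \<bar>t - c\<bar> \<le> (cmod z)\<^sup>2 * cmod (of_real t - w)"
      by (intro mult_left_mono) auto
    also have "\<dots> = cmod (z\<^sup>2 * (of_real t - w))"
      by (simp add: norm_mult norm_power)
    also have "z\<^sup>2 * (of_real t - w) = rk_factor t z"
      using assms by (simp add: w_def rk_factor_def field_simps)
    finally show ?thesis .
  qed
  moreover have "0 \<le> c" "c \<le> 1" by (auto simp: c_def)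
  ultimately show ?thesis using that by blast
qed

lemma AE_rk_factor_nonzero: "AE t in unif01. rk_factor t z \<noteq> 0"
proof (cases "z = 0")
  case False
  from cmod_rk_factor_ge_dist[OF this] obtain c where
    c: "\<And>t. t \<in> {0..1} \<Longrightarrow> (cmod z)\<^sup>2 * \<bar>t - c\<bar> \<le> cmod (rk_factor t z)" by blast
  have key: "rk_factor t z \<noteq> 0" if "t \<in> {0..1}" "t \<noteq> c" for t
  proof
    assume "rk_factor t z = 0"
    then have "(cmod z)\<^sup>2 * \<bar>t - c\<bar> \<le> 0"
      using c[OF that(1)] by simp
    moreover have "0 < (cmod z)\<^sup>2 * \<bar>t - c\<bar>"
      using False that by (intro mult_pos_pos) auto
    ultimately show False by simp
  qed
  show ?thesis
    using AE_unif01_unit_interval AE_unif01_neq[of c] by eventually_elim (rule key)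
qed simp

definition mean_log_factor :: "complex \<Rightarrow> real" where
  "mean_log_factor z = (\<integral>t. ln (cmod (rk_factor t z)) \<partial>unif01)"

text \<open>For \<open>z \<noteq> 0\<close> the factor lies between \<open>\<bar>z\<bar>\<^sup>2 \<bar>t - c\<bar>\<close> and \<open>\<bar>z\<bar>\<^sup>2 + \<bar>z\<bar> + 1\<close>, so up to an additive constant
  the absolute value of its logarithm is at most that of \<open>ln \<bar>t - c\<bar>\<close>.\<close>

lemma integrable_ln_rk_factor_square: "integrable unif01 (\<lambda>t. (ln (cmod (rk_factor t z)))\<^sup>2)"
proof (cases "z = 0")
  case False
  obtain c where c01: "0 \<le> c" "c \<le> 1" and
    c: "\<And>t. t \<in> {0..1} \<Longrightarrow> (cmod z)\<^sup>2 * \<bar>t - c\<bar> \<le> cmod (rk_factor t z)"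
    using cmod_rk_factor_ge_dist[OF False] by blast
  define K where "K = \<bar>ln ((cmod z)\<^sup>2 + cmod z + 1)\<bar> + \<bar>ln ((cmod z)\<^sup>2)\<bar>"
  show ?thesis
  proof (rule Bochner_Integration.integrable_bound)
    show "integrable unif01 (\<lambda>t. 2 * K\<^sup>2 + 2 * (ln \<bar>t - c\<bar>)\<^sup>2)"
      using integrable_unif01_ln_dist_square[OF c01] by simp
    have key: "(ln (cmod (rk_factor t z)))\<^sup>2 \<le> 2 * K\<^sup>2 + 2 * (ln \<bar>t - c\<bar>)\<^sup>2"
      if t: "t \<in> {0..1}" "t \<noteq> c" "rk_factor t z \<noteq> 0" for t
    proof -
      let ?L = "ln (cmod (rk_factor t z))"
      have "?L \<le> ln ((cmod z)\<^sup>2 + cmod z + 1)"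
        using cmod_rk_factor_le[OF t(1), of z] t(3) by (intro ln_mono) auto
      moreover have "ln ((cmod z)\<^sup>2 * \<bar>t - c\<bar>) \<le> ?L"
        using c[OF t(1)] t False by (intro ln_mono) auto
      then have "ln ((cmod z)\<^sup>2) + ln \<bar>t - c\<bar> \<le> ?L"
        using t False by (subst (asm) ln_mult) auto
      ultimately have "\<bar>?L\<bar> \<le> K + \<bar>ln \<bar>t - c\<bar>\<bar>"
        unfolding K_def by linarith
      then have "?L\<^sup>2 \<le> (K + \<bar>ln \<bar>t - c\<bar>\<bar>)\<^sup>2"
        by (metis abs_ge_zero power2_abs power_mono)
      also have "\<dots> \<le> 2 * K\<^sup>2 + 2 * (ln \<bar>t - c\<bar>)\<^sup>2"
        using sum_squares_ge_zero[of "K - \<bar>ln \<bar>t - c\<bar>\<bar>" 0]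
        by (simp add: power2_eq_square algebra_simps)
      finally show ?thesis .
    qed
    show "AE t in unif01. norm ((ln (cmod (rk_factor t z)))\<^sup>2)
        \<le> norm (2 * K\<^sup>2 + 2 * (ln \<bar>t - c\<bar>)\<^sup>2)"
      using AE_unif01_unit_interval AE_unif01_neq[of c] AE_rk_factor_nonzero[of z]
    proof eventually_elim
      case (elim t)
      then show ?case using key[of t] by simp
    qed
  qed measurable
qed simp

lemma integrable_ln_rk_factor: "integrable unif01 (\<lambda>t. ln (cmod (rk_factor t z)))"
  by (rule unif01.square_integrable_imp_integrable[OF _ integrable_ln_rk_factor_square]) measurable

section \<open>The sign of the mean logarithm\<close>

lemma mean_log_factor_cnj: "mean_log_factor (cnj z) = mean_log_factor z"
  by (simp add: mean_log_factor_def rk_factor_cnj)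

text \<open>By convexity each summand lies above the tangent of \<open>x ln x\<close> at \<open>1 / 2\<close>. In other words, the
  entropy of a two-point distribution is largest for equal weights.\<close>

lemma mult_ln_sum_ge:
  fixes a b :: real
  assumes "0 \<le> a" "0 \<le> b" "a + b = 1"
  shows "- ln 2 \<le> a * ln a + b * ln b"
proof -
  have *: "a - 1 / 2 \<le> a * (ln a + ln 2)" if "0 \<le> a" for a :: real
  proof (cases "a = 0")
    case False
    then have "ln (1 / (2 * a)) \<le> 1 / (2 * a) - 1"
      using that by (intro ln_le_minus_one) auto
    moreover have "ln (1 / (2 * a)) = - (ln a + ln 2)"
      using False that by (simp add: ln_div ln_mult)
    ultimately have "a * (1 - 1 / (2 * a)) \<le> a * (ln a + ln 2)"
      using that by (intro mult_left_mono) auto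
    then show ?thesis
      using False by (simp add: algebra_simps)
  qed simp
  have "a * ln 2 + b * ln 2 = ln 2"
    using assms(3) by (metis distrib_right mult_1)
  then show ?thesis
    using *[OF assms(1)] *[OF assms(2)] assms(3) unfolding distrib_left by linarith
qed

text \<open>Among all \<open>c\<close> in the unit interval, the integral of \<open>ln \<bar>t - c\<bar>\<close> is smallest at the
  midpoint, where it equals \<open>- ln (2 e)\<close>.\<close>

lemma mean_log_factor_ge:
  assumes "z \<noteq> 0"
  shows "ln ((cmod z)\<^sup>2 / (2 * exp 1)) \<le> mean_log_factor z"
proof -
  obtain c where c01: "0 \<le> c" "c \<le> 1" and
    c: "\<And>t. t \<in> {0..1} \<Longrightarrow> (cmod z)\<^sup>2 * \<bar>t - c\<bar> \<le> cmod (rk_factor t z)"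
    using cmod_rk_factor_ge_dist[OF assms] by blast
  have "ln ((cmod z)\<^sup>2 / (2 * exp 1)) = ln ((cmod z)\<^sup>2) - ln 2 - 1"
    using assms by (simp add: ln_div ln_mult)
  also have "\<dots> \<le> ln ((cmod z)\<^sup>2) + (c * ln c + (1 - c) * ln (1 - c) - 1)"
    using mult_ln_sum_ge[of c "1 - c"] c01 by simp
  also have "\<dots> = (\<integral>t. ln ((cmod z)\<^sup>2) + ln \<bar>t - c\<bar> \<partial>unif01)"
    using integral_unif01_ln_dist[OF c01] unif01.prob_space by simp
  also have "\<dots> \<le> mean_log_factor z"
    unfolding mean_log_factor_def
  proof (rule integral_mono_AE)
    have key: "ln ((cmod z)\<^sup>2) + ln \<bar>t - c\<bar> \<le> ln (cmod (rk_factor t z))"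
      if t: "t \<in> {0..1}" "t \<noteq> c" for t
    proof -
      have "ln ((cmod z)\<^sup>2) + ln \<bar>t - c\<bar> = ln ((cmod z)\<^sup>2 * \<bar>t - c\<bar>)"
        using t assms by (subst ln_mult) auto
      also have "\<dots> \<le> ln (cmod (rk_factor t z))"
        using c[OF t(1)] t assms by (intro ln_mono) auto
      finally show ?thesis .
    qed
    show "AE t in unif01. ln ((cmod z)\<^sup>2) + ln \<bar>t - c\<bar> \<le> ln (cmod (rk_factor t z))"
      using AE_unif01_unit_interval AE_unif01_neq[of c] by eventually_elim (rule key)
  qed (use integral_unif01_ln_dist(1)[OF c01] integrable_ln_rk_factor in auto)
  finally show ?thesis .
qed

lemma mean_log_factor_nonneg_large:
  assumes "sqrt (2 * exp 1) \<le> cmod z"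
  shows "0 \<le> mean_log_factor z"
proof -
  have "2 * exp 1 \<le> (cmod z)\<^sup>2"
    using assms by (rule sqrt_le_D)
  then have "0 \<le> ln ((cmod z)\<^sup>2 / (2 * exp 1))"
    by (intro ln_ge_zero) (simp add: field_simps)
  also have "\<dots> \<le> mean_log_factor z"
  proof (rule mean_log_factor_ge)
    show "z \<noteq> 0" using \<open>2 * exp 1 \<le> (cmod z)\<^sup>2\<close> by auto
  qed
  finally show ?thesis .
qed

text \<open>The coefficients of this quadratic polynomial in \<open>t\<close> serve twice: in the estimate on the
  right half-plane, and, since its leading coefficient is nonzero for \<open>z \<noteq> 0\<close>, in the proof that
  the modulus of the factor is not almost surely constant.\<close>

lemma cmod_rk_factor_square:
  "(cmod (rk_factor t z))\<^sup>2 = (cmod z) ^ 4 * t\<^sup>2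
    + 2 * (2 * (Re z)\<^sup>2 + (Re z - 1) * (cmod z)\<^sup>2) * t + (1 + 2 * Re z + (cmod z)\<^sup>2)"
proof -
  obtain x y where z: "z = Complex x y" by (cases z)
  have r: "(cmod z)\<^sup>2 = x\<^sup>2 + y\<^sup>2"
    by (simp add: z cmod_power2)
  have "(cmod z) ^ 4 = (x\<^sup>2 + y\<^sup>2)\<^sup>2"
    unfolding r[symmetric] by simp
  moreover have "(cmod (rk_factor t z))\<^sup>2 = (t * (x\<^sup>2 - y\<^sup>2) + x + 1)\<^sup>2 + (t * (2 * x * y) + y)\<^sup>2"
    unfolding cmod_power2 rk_factor_def by (simp add: z power2_eq_square mult.assoc)
  ultimately show ?thesis
    unfolding r by (simp add: z power2_eq_square) (simp add: algebra_simps)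
qed

text \<open>The left-hand side is the value of the squared modulus at the point \<open>\<i> \<bar>z\<bar>\<close> of the imaginary
  axis, so among the points of the closed right half-plane with given modulus the imaginary ones
  are extremal.\<close>

lemma cmod_rk_factor_square_ge:
  assumes "0 \<le> Re z" "0 \<le> t"
  shows "(1 - t * (cmod z)\<^sup>2)\<^sup>2 + (cmod z)\<^sup>2 \<le> (cmod (rk_factor t z))\<^sup>2"
proof -
  define r where "r = (cmod z)\<^sup>2"
  have "(cmod z) ^ 4 = r\<^sup>2" by (simp add: r_def)
  then have "(cmod (rk_factor t z))\<^sup>2 - ((1 - t * r)\<^sup>2 + r)
      = 2 * Re z + 4 * (Re z)\<^sup>2 * t + 2 * Re z * r * t"
    unfolding cmod_rk_factor_square r_def[symmetric]
    by (simp add: power2_eq_square algebra_simps)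
  also have "\<dots> \<ge> 0"
    using assms by (simp add: r_def)
  finally show ?thesis by (simp add: r_def)
qed

text \<open>On the imaginary axis a single factor can have modulus below \<open>1\<close> when \<open>t > 1 / 2\<close>, but in the
  product of the factors for \<open>t\<close> and \<open>1 - t\<close> the terms linear in \<open>r\<close> cancel and the remaining
  coefficients are nonnegative.\<close>

lemma reflected_quadratics_prod_ge_1:
  fixes r t :: real
  assumes "0 \<le> r" "0 \<le> t" "t \<le> 1"
  shows "1 \<le> ((1 - t * r)\<^sup>2 + r) * ((1 - (1 - t) * r)\<^sup>2 + r)"
proof -
  have "((1 - t * r)\<^sup>2 + r) * ((1 - (1 - t) * r)\<^sup>2 + r) - 1
      = 2 * (t * (1 - t)) * r\<^sup>2 + (1 - 2 * t)\<^sup>2 * r ^ 3 + (t * (1 - t))\<^sup>2 * r ^ 4"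
    by (simp add: power2_eq_square power3_eq_cube power4_eq_xxxx) (simp add: algebra_simps)
  also have "\<dots> \<ge> 0"
    using assms by (intro add_nonneg_nonneg mult_nonneg_nonneg) auto
  finally show ?thesis by simp
qed

lemma mean_log_factor_nonneg_Re:
  assumes "0 \<le> Re z"
  shows "0 \<le> mean_log_factor z"
proof -
  let ?L = "\<lambda>t. ln (cmod (rk_factor t z))"
  have L [measurable]: "?L \<in> borel_measurable borel" by measurable
  have "0 \<le> (\<integral>t. ?L t + ?L (1 - t) \<partial>unif01)"
  proof (rule integral_nonneg_AE)
    have key: "0 \<le> ?L t + ?L (1 - t)" if t: "t \<in> {0..1}" for t
    proof -
      let ?r = "(cmod z)\<^sup>2" and ?p = "cmod (rk_factor t z)" and ?q = "cmod (rk_factor (1 - t) z)"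
      have "1 \<le> ((1 - t * ?r)\<^sup>2 + ?r) * ((1 - (1 - t) * ?r)\<^sup>2 + ?r)"
        using t by (intro reflected_quadratics_prod_ge_1) auto
      also have "\<dots> \<le> ?p\<^sup>2 * ?q\<^sup>2"
        using t assms by (intro mult_mono cmod_rk_factor_square_ge) auto
      finally have "1\<^sup>2 \<le> (?p * ?q)\<^sup>2"
        by (simp add: power_mult_distrib)
      then have "1 \<le> ?p * ?q"
        by (rule power2_le_imp_le) simp
      moreover from this have "?p \<noteq> 0" "?q \<noteq> 0" by auto
      ultimately show ?thesis
        using ln_ge_zero[of "?p * ?q"] by (simp add: ln_mult)
    qed
    show "AE t in unif01. 0 \<le> ?L t + ?L (1 - t)"
      using AE_unif01_unit_interval by eventually_elim (rule key)
  qed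
  also have "\<dots> = mean_log_factor z + (\<integral>t. ?L (1 - t) \<partial>unif01)"
    unfolding mean_log_factor_def
    by (intro Bochner_Integration.integral_add integrable_ln_rk_factor
          integrable_unif01_reflect[where g = ?L] L)
  also have "(\<integral>t. ?L (1 - t) \<partial>unif01) = mean_log_factor z"
    unfolding mean_log_factor_def by (rule integral_unif01_reflect[OF L])
  finally show ?thesis by simp
qed

lemma integral_unif01_id: "integrable unif01 (\<lambda>t. t)" "(\<integral>t. t \<partial>unif01) = 1 / 2"
proof -
  have "((\<lambda>t::real. t) has_integral 1 / 2) {0..1}"
    using ident_has_integral[of 0 "1::real"] by simp
  then show "integrable unif01 (\<lambda>t. t)" "(\<integral>t. t \<partial>unif01) = 1 / 2"
    by (rule has_integral_imp_integral_unif01[rotated 2]; simp)+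
qed

text \<open>For \<open>x \<ge> -1\<close> the factor is nonnegative on the whole unit interval, so \<open>ln p \<le> p - 1\<close> applies
  and the mean of \<open>p - 1\<close> is \<open>x (x + 2) / 2\<close>.\<close>

lemma mean_log_factor_neg_Jensen:
  assumes x: "-1 \<le> x" "x < 0"
  shows "mean_log_factor (of_real x) < 0"
proof -
  have "mean_log_factor (of_real x) \<le> (\<integral>t. t * x\<^sup>2 + x \<partial>unif01)"
    unfolding mean_log_factor_def
  proof (rule integral_mono_AE)
    have key: "ln (cmod (rk_factor t (of_real x))) \<le> t * x\<^sup>2 + x"
      if t: "t \<in> {0..1}" "rk_factor t (of_real x) \<noteq> 0" for t
    proof -
      have "0 \<le> t * x\<^sup>2" using t by simp
      then have "0 \<le> t * x\<^sup>2 + x + 1" using x by linarith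
      then have "cmod (rk_factor t (of_real x)) = t * x\<^sup>2 + x + 1"
        unfolding rk_factor_of_real norm_of_real by simp
      then show ?thesis
        using ln_le_minus_one[of "t * x\<^sup>2 + x + 1"] t(2) by (metis add_diff_cancel_right' zero_less_norm_iff)
    qed
    show "AE t in unif01. ln (cmod (rk_factor t (of_real x))) \<le> t * x\<^sup>2 + x"
      using AE_unif01_unit_interval AE_rk_factor_nonzero[of "of_real x"] by eventually_elim (rule key)
  qed (use integral_unif01_id integrable_ln_rk_factor in auto)
  also have "\<dots> = x\<^sup>2 / 2 + x"
    using integral_unif01_id unif01.prob_space by simp
  also have "\<dots> = x * (x + 2) / 2"
    by (simp add: power2_eq_square algebra_simps)
  also have "\<dots> < 0"
    using x by (simp add: mult_neg_pos)
  finally show ?thesis .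
qed

text \<open>For \<open>x < -1\<close> the factor increases from \<open>-a\<close> to \<open>b\<close> with \<open>a = -(x + 1)\<close> and \<open>a + b = x\<^sup>2\<close>, so
  \<open>x\<^sup>2 f x = a ln a + b ln b - (a + b)\<close>. The first summand is at most \<open>0\<close> as \<open>a \<le> 1\<close>. For the
  second, \<open>ln b \<le> b / e\<close> reduces the claim to \<open>b\<^sup>2 < e x\<^sup>2\<close>, which follows from
  \<open>b \<le> 3 / 2 (1 + a)\<close> and \<open>9 / 4 < e\<close>.\<close>

lemma mean_log_factor_neg_closed_form:
  assumes x: "-2 \<le> x" "x < -1"
  shows "mean_log_factor (of_real x) < 0"
proof -
  define a where "a = - (x + 1)"
  define b where "b = a\<^sup>2 + a + 1"
  \<comment> \<open>The zero of the factor as a function of \<open>t\<close>.\<close>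
  define c where "c = a / x\<^sup>2"
  have a: "0 < a" "a \<le> 1" using x by (auto simp: a_def)
  have b: "0 < b" using a by (simp add: b_def add_pos_pos)
  have ab: "a + b = x\<^sup>2" "x\<^sup>2 = (1 + a)\<^sup>2"
    by (simp_all add: a_def b_def power2_eq_square algebra_simps)
  have x2: "x\<^sup>2 > 0" using x by simp
  have c': "1 - c = b / x\<^sup>2"
    using x2 ab(1) by (simp add: c_def field_simps)
  have "0 < 1 - c"
    unfolding c' using b x2 by (rule divide_pos_pos)
  moreover have "0 < c"
    unfolding c_def using a(1) x2 by (rule divide_pos_pos)
  ultimately have c01: "0 < c" "c < 1"
    by auto
  have "mean_log_factor (of_real x) = (\<integral>t. ln (x\<^sup>2) + ln \<bar>t - c\<bar> \<partial>unif01)"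
    unfolding mean_log_factor_def
  proof (rule integral_cong_AE)
    have key: "ln (cmod (rk_factor t (of_real x))) = ln (x\<^sup>2) + ln \<bar>t - c\<bar>" if "t \<noteq> c" for t
    proof -
      have "t * x\<^sup>2 + x + 1 = x\<^sup>2 * (t - c)"
        using x2 by (simp add: c_def a_def field_simps)
      then have "cmod (rk_factor t (of_real x)) = x\<^sup>2 * \<bar>t - c\<bar>"
        unfolding rk_factor_of_real norm_of_real by (simp add: abs_mult)
      then show ?thesis
        using that x2 by (simp add: ln_mult)
    qed
    show "AE t in unif01. ln (cmod (rk_factor t (of_real x))) = ln (x\<^sup>2) + ln \<bar>t - c\<bar>"
      using AE_unif01_neq[of c] by eventually_elim (rule key)
  qed measurable
  also have "\<dots> = ln (x\<^sup>2) + (c * ln c + (1 - c) * ln (1 - c) - 1)"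
    using integral_unif01_ln_dist[of c] c01 unif01.prob_space by simp
  also have "\<dots> = c * ln a + (1 - c) * ln b - 1"
  proof -
    have *: "ln c = ln a - ln (x\<^sup>2)" "ln (1 - c) = ln b - ln (x\<^sup>2)"
      unfolding c' using a b x2 by (auto simp: c_def ln_div)
    show ?thesis unfolding * by (simp add: algebra_simps)
  qed
  also have "\<dots> \<le> (1 - c) * ln b - 1"
    using a c01 by (simp add: mult_nonneg_nonpos)
  also have "\<dots> < 0"
  proof -
    have "ln (b / exp 1) \<le> b / exp 1 - 1"
      using b by (intro ln_le_minus_one) auto
    then have "b * ln b \<le> b * (b / exp 1)"
      using b by (intro mult_left_mono) (auto simp: ln_div)
    also have "\<dots> = b\<^sup>2 / exp 1"
      by (simp add: power2_eq_square)
    also have "\<dots> \<le> (3 / 2 * (1 + a))\<^sup>2 / exp 1"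
    proof -
      have "a\<^sup>2 \<le> a" using a by (simp add: power2_eq_square mult_left_le)
      then have "b \<le> 3 / 2 * (1 + a)" using a by (simp add: b_def)
      then show ?thesis using b by (intro divide_right_mono power_mono) auto
    qed
    also have "\<dots> = 9 / 4 * x\<^sup>2 / exp 1"
      unfolding ab(2) power_mult_distrib by (simp add: power2_eq_square)
    also have "\<dots> < x\<^sup>2"
    proof -
      have "5 / 2 \<le> exp (1::real)"
        using exp_lower_Taylor_quadratic[of "1::real"] by simp
      then have "9 / 4 * x\<^sup>2 < exp 1 * x\<^sup>2"
        using x2 by (intro mult_strict_right_mono) auto
      then show ?thesis by (simp add: divide_less_eq mult_ac)
    qed
    finally show ?thesis
      using x2 by (simp add: c' field_simps)
  qed
  finally show ?thesis .
qed

section \<open>Fractional moments of the random factor\<close>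

lemma integrable_rk_factor_powr:
  assumes "0 < s"
  shows "integrable unif01 (\<lambda>t. cmod (rk_factor t z) powr s)"
    and "(\<integral>t. cmod (rk_factor t z) powr s \<partial>unif01) = integral {0..1} (\<lambda>t. cmod (rk_factor t z) powr s)"
proof -
  have "continuous_on {0..1} (\<lambda>t. cmod (rk_factor t z) powr s)"
    unfolding rk_factor_def using assms by (intro continuous_on_powr' continuous_intros) auto
  then have "((\<lambda>t. cmod (rk_factor t z) powr s) has_integral
      integral {0..1} (\<lambda>t. cmod (rk_factor t z) powr s)) {0..1}"
    by (intro integrable_integral integrable_continuous_real)
  then show "integrable unif01 (\<lambda>t. cmod (rk_factor t z) powr s)"
    "(\<integral>t. cmod (rk_factor t z) powr s \<partial>unif01) = integral {0..1} (\<lambda>t. cmod (rk_factor t z) powr s)"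
    by (rule has_integral_imp_integral_unif01[rotated 2]; simp)+
qed

lemma continuous_moment_rk_factor:
  assumes "0 < s"
  shows "continuous_on UNIV (\<lambda>z. \<integral>t. cmod (rk_factor t z) powr s \<partial>unif01)"
proof -
  have "continuous_on (UNIV \<times> cbox 0 1) (\<lambda>(z, t). cmod (rk_factor t z) powr s)"
    unfolding rk_factor_def case_prod_unfold using assms
    by (intro continuous_on_powr' continuous_intros) auto
  from integral_continuous_on_param[OF this] show ?thesis
    by (simp add: integrable_rk_factor_powr(2)[OF assms])
qed

lemma powr_minus_one_over_tendsto_ln:
  fixes x :: real
  assumes "0 < x"
  shows "(\<lambda>n. (x powr (1 / real (Suc n)) - 1) / (1 / real (Suc n))) \<longlonglongrightarrow> ln x"
proof -
  have "((\<lambda>s. x powr s) has_real_derivative ln x) (at 0)"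
    using assms by (auto intro!: derivative_eq_intros)
  then have "((\<lambda>s. (x powr s - 1) / s) \<longlongrightarrow> ln x) (at 0)"
    using assms by (simp add: DERIV_def)
  moreover have "filterlim (\<lambda>n. 1 / real (Suc n)) (at 0) sequentially"
    by (rule filterlim_atI) (use LIMSEQ_inverse_real_of_nat in \<open>auto simp: inverse_eq_divide\<close>)
  ultimately show ?thesis
    by (rule filterlim_compose)
qed

lemma powr_minus_one_over_bounds:
  fixes x s :: real
  assumes "0 < x" "0 < s" "s \<le> 1"
  shows "ln x \<le> (x powr s - 1) / s" "(x powr s - 1) / s \<le> x"
proof -
  have "ln (x powr s) \<le> x powr s - 1"
    using assms by (intro ln_le_minus_one) auto
  then show "ln x \<le> (x powr s - 1) / s"
    using assms by (simp add: ln_powr field_simps)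
  have "x powr s * 1 powr (1 - s) \<le> s * x + (1 - s) * 1"
    using assms by (intro Youngs_inequality_0) auto
  then have "x powr s - 1 \<le> s * x"
    using assms by simp
  then show "(x powr s - 1) / s \<le> x"
    using assms by (simp add: field_simps)
qed

text \<open>The quotients \<open>(E p\<^sup>s - 1) / s\<close> bound \<open>E (ln p)\<close> from above for every \<open>s > 0\<close> and converge to it along
  \<open>s = 1 / (n + 1)\<close>; dominated convergence applies because for \<open>s \<le> 1\<close> the integrands lie
  between \<open>ln p\<close> and \<open>p\<close>.\<close>

lemma mean_log_factor_neg_iff_moment:
  "mean_log_factor z < 0 \<longleftrightarrow> (\<exists>s>0. (\<integral>t. cmod (rk_factor t z) powr s \<partial>unif01) < 1)"
proof
  assume neg: "mean_log_factor z < 0"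
  define q where "q = (\<lambda>n t. (cmod (rk_factor t z) powr (1 / real (Suc n)) - 1) / (1 / real (Suc n)))"
  have "(\<lambda>n. integral\<^sup>L unif01 (q n)) \<longlonglongrightarrow> (\<integral>t. ln (cmod (rk_factor t z)) \<partial>unif01)"
  proof (rule integral_dominated_convergence)
    show "integrable unif01 (\<lambda>t. \<bar>ln (cmod (rk_factor t z))\<bar> + ((cmod z)\<^sup>2 + cmod z + 1))"
      using integrable_ln_rk_factor by simp
    show "AE t in unif01. (\<lambda>n. q n t) \<longlonglongrightarrow> ln (cmod (rk_factor t z))"
      using AE_rk_factor_nonzero[of z]
      unfolding q_def by eventually_elim (rule powr_minus_one_over_tendsto_ln, simp)
    show "AE t in unif01. norm (q n t) \<le> \<bar>ln (cmod (rk_factor t z))\<bar> + ((cmod z)\<^sup>2 + cmod z + 1)" for n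
      using AE_rk_factor_nonzero[of z] AE_unif01_unit_interval
    proof eventually_elim
      case (elim t)
      have "ln (cmod (rk_factor t z)) \<le> q n t" "q n t \<le> cmod (rk_factor t z)"
        unfolding q_def using elim(1) by (intro powr_minus_one_over_bounds; simp)+
      moreover have "cmod (rk_factor t z) \<le> (cmod z)\<^sup>2 + cmod z + 1"
        using elim(2) by (rule cmod_rk_factor_le)
      moreover have "0 \<le> cmod (rk_factor t z)" by simp
      ultimately show ?case unfolding real_norm_def by linarith
    qed
  qed (unfold q_def, measurable)
  then have "\<forall>\<^sub>F n in sequentially. integral\<^sup>L unif01 (q n) < 0"
    using neg by (intro order_tendstoD) (auto simp: mean_log_factor_def)
  then obtain n where "integral\<^sup>L unif01 (q n) < 0"
    by (auto simp: eventually_sequentially)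
  moreover have "integral\<^sup>L unif01 (q n) = ((\<integral>t. cmod (rk_factor t z) powr (1 / real (Suc n)) \<partial>unif01) - 1) / (1 / real (Suc n))"
    unfolding q_def integral_divide_zero
    by (subst Bochner_Integration.integral_diff) (use integrable_rk_factor_powr unif01.prob_space in auto)
  ultimately have "(\<integral>t. cmod (rk_factor t z) powr (1 / real (Suc n)) \<partial>unif01) < 1"
    by (simp add: mult_less_0_iff)
  then show "\<exists>s>0. (\<integral>t. cmod (rk_factor t z) powr s \<partial>unif01) < 1"
    by (intro exI[of _ "1 / real (Suc n)"]) simp
next
  assume "\<exists>s>0. (\<integral>t. cmod (rk_factor t z) powr s \<partial>unif01) < 1"
  then obtain s where s: "s > 0" "(\<integral>t. cmod (rk_factor t z) powr s \<partial>unif01) < 1" by blast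
  have "s * mean_log_factor z = (\<integral>t. s * ln (cmod (rk_factor t z)) \<partial>unif01)"
    by (simp add: mean_log_factor_def)
  also have "\<dots> \<le> (\<integral>t. cmod (rk_factor t z) powr s - 1 \<partial>unif01)"
  proof (rule integral_mono_AE)
    show "AE t in unif01. s * ln (cmod (rk_factor t z)) \<le> cmod (rk_factor t z) powr s - 1"
      using AE_rk_factor_nonzero[of z]
    proof eventually_elim
      case (elim t)
      then show ?case
        using ln_le_minus_one[of "cmod (rk_factor t z) powr s"] by (simp add: ln_powr)
    qed
  qed (use integrable_rk_factor_powr[OF s(1)] integrable_ln_rk_factor in auto)
  also have "\<dots> = (\<integral>t. cmod (rk_factor t z) powr s \<partial>unif01) - 1"
    using integrable_rk_factor_powr[OF s(1)] unif01.prob_space by simp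
  also have "\<dots> < 0" using s by simp
  finally show "mean_log_factor z < 0"
    using s(1) by (simp add: mult_less_0_iff)
qed

lemma open_mean_log_factor_neg: "open {z. mean_log_factor z < 0}"
proof -
  have "{z. mean_log_factor z < 0} = (\<Union>s\<in>{0<..}. {z. (\<integral>t. cmod (rk_factor t z) powr s \<partial>unif01) < 1})"
    by (auto simp: mean_log_factor_neg_iff_moment)
  also have "open \<dots>"
    by (intro open_UN ballI open_Collect_less continuous_moment_rk_factor continuous_on_const) auto
  finally show ?thesis .
qed

section \<open>Random walks with nonnegative drift and products with a small moment\<close>

lemma (in prob_space) indep_sets_reindex:
  assumes inj: "inj_on f I" and indep: "indep_sets F (f ` I)"
  shows "indep_sets (\<lambda>i. F (f i)) I"
  unfolding indep_sets_def
proof (intro conjI ballI allI impI)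
  fix i assume "i \<in> I"
  then show "F (f i) \<subseteq> events"
    using indep by (auto simp: indep_sets_def)
next
  fix J B assume J: "J \<subseteq> I" "J \<noteq> {}" "finite J" and B: "B \<in> (\<Pi> i\<in>J. F (f i))"
  have injJ: "inj_on f J" using inj J(1) by (rule inj_on_subset)
  define C where "C = (\<lambda>k. B (the_inv_into J f k))"
  have C: "C (f j) = B j" if "j \<in> J" for j
    using the_inv_into_f_f[OF injJ that] by (simp add: C_def)
  have "prob (\<Inter>k\<in>f ` J. C k) = (\<Prod>k\<in>f ` J. prob (C k))"
    using indep J B C by (intro indep_setsD[OF indep]) auto
  then show "prob (\<Inter>j\<in>J. B j) = (\<Prod>j\<in>J. prob (B j))"
    using C by (simp add: prod.reindex[OF injJ])
qed

lemma (in prob_space) indep_vars_reindex: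
  assumes "inj_on f I" and "indep_vars N X (f ` I)"
  shows "indep_vars (\<lambda>i. N (f i)) (\<lambda>i. X (f i)) I"
  using assms unfolding indep_vars_def2
  by (auto intro: indep_sets_reindex[where F = "\<lambda>i. {X i -` A \<inter> space M |A. A \<in> sets (N i)}"])

lemma std_normal_not_AE_nonpos: "\<not> (AE x in std_normal_distribution. x \<le> 0)"
proof
  assume "AE x in std_normal_distribution. x \<le> 0"
  then have "AE x in lborel. x \<le> (0::real)"
    by (subst (asm) AE_density) (auto simp: normal_density_pos)
  then have "AE x in lborel. x \<notin> {0<..<1::real}"
    by eventually_elim auto
  then have "{0<..<1::real} \<in> null_sets lborel"
    by (subst AE_iff_null_sets) auto
  then show False by (simp add: null_sets_def)
qed

lemma cdf_std_normal_0_less_1: "cdf std_normal_distribution 0 < 1"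
proof -
  interpret N: real_distribution std_normal_distribution
    by (rule real_dist_normal_dist)
  have "N.prob {..0} \<noteq> 1"
    using std_normal_not_AE_nonpos N.prob_eq_1[of "{..0}"] by auto
  then show ?thesis
    using N.prob_le_1[of "{..0}"] unfolding cdf_def by linarith
qed

lemma isCont_cdf_std_normal: "isCont (cdf std_normal_distribution) x"
proof -
  interpret N: real_distribution std_normal_distribution
    by (rule real_dist_normal_dist)
  have "emeasure std_normal_distribution {x} = 0"
    by (subst emeasure_density) (auto simp: nn_integral_indicator_singleton)
  then show ?thesis
    unfolding N.isCont_cdf by (simp add: measure_def)
qed

lemma (in prob_space) prob_tendsto_1_if_AE_eventually:
  assumes meas: "\<And>n. {\<omega> \<in> space M. P n \<omega>} \<in> events"
    and ev: "AE \<omega> in M. \<forall>\<^sub>F n in sequentially. P n \<omega>"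
  shows "(\<lambda>n. prob {\<omega> \<in> space M. P n \<omega>}) \<longlonglongrightarrow> 1"
proof -
  let ?A = "\<lambda>n. {\<omega> \<in> space M. P n \<omega>}"
  have "(\<lambda>n. \<integral>\<omega>. indicat_real (?A n) \<omega> \<partial>M) \<longlonglongrightarrow> (\<integral>\<omega>. 1 \<partial>M)"
  proof (rule integral_dominated_convergence)
    show "AE \<omega> in M. (\<lambda>n. indicat_real (?A n) \<omega>) \<longlonglongrightarrow> 1"
      using ev AE_space
    proof eventually_elim
      case (elim \<omega>)
      from elim(1) have "\<forall>\<^sub>F n in sequentially. indicat_real (?A n) \<omega> = 1"
        by eventually_elim (use elim(2) in auto)
      then show ?case by (rule tendsto_eventually)
    qed
    show "AE \<omega> in M. norm (indicat_real (?A n) \<omega>) \<le> 1" for n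
      by (auto simp: indicator_def)
  qed (use meas in auto)
  then show ?thesis
    using meas prob_space by simp
qed

text \<open>The centred sums are dominated by the sums themselves when the drift is nonnegative, so if the
  walk were eventually nonpositive, the normalised centred sums would be nonpositive with
  probability tending to \<open>1\<close>. By the central limit theorem this probability tends to that of the
  negative half-line under the normal distribution, which is less than \<open>1\<close>.\<close>

lemma (in prob_space) random_walk_not_AE_eventually_nonpos:
  fixes X :: "nat \<Rightarrow> 'a \<Rightarrow> real"
  assumes indep: "indep_vars (\<lambda>_. borel) X UNIV"
    and mean: "\<And>n. expectation (X n) = m" "0 \<le> m"
    and square: "\<And>n. integrable M (\<lambda>\<omega>. (X n \<omega>)\<^sup>2)"
    and var: "\<And>n. variance (X n) = v" "0 < v"
    and distr: "\<And>n. distr M borel (X n) = \<mu>"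
  shows "\<not> (AE \<omega> in M. \<forall>\<^sub>F n in sequentially. (\<Sum>i<n. X i \<omega>) \<le> 0)"
proof
  assume AE: "AE \<omega> in M. \<forall>\<^sub>F n in sequentially. (\<Sum>i<n. X i \<omega>) \<le> 0"
  have [measurable]: "random_variable borel (X n)" for n
    using indep unfolding indep_vars_def2 by simp
  define S where "S = (\<lambda>n \<omega>. (\<Sum>i<n. X i \<omega> - m) / sqrt (n * (sqrt v)\<^sup>2))"
  have [measurable]: "random_variable borel (S n)" for n
    unfolding S_def by measurable
  have "weak_conv_m (\<lambda>n. distr M borel (S n)) std_normal_distribution"
    unfolding S_def using var
    by (intro central_limit_theorem[OF indep mean(1) _ square _ distr]) auto
  then have "(\<lambda>n. cdf (distr M borel (S n)) 0) \<longlonglongrightarrow> cdf std_normal_distribution 0"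
    using isCont_cdf_std_normal unfolding weak_conv_m_def weak_conv_def by blast
  moreover have "(\<lambda>n. cdf (distr M borel (S n)) 0) \<longlonglongrightarrow> 1"
  proof (rule tendsto_sandwich)
    show "(\<lambda>n. prob {\<omega> \<in> space M. (\<Sum>i<n. X i \<omega>) \<le> 0}) \<longlonglongrightarrow> 1"
      using AE by (intro prob_tendsto_1_if_AE_eventually) measurable
    show "\<forall>\<^sub>F n in sequentially. prob {\<omega> \<in> space M. (\<Sum>i<n. X i \<omega>) \<le> 0}
        \<le> cdf (distr M borel (S n)) 0"
    proof (intro always_eventually allI)
      fix n
      have "S n \<omega> \<le> 0" if "(\<Sum>i<n. X i \<omega>) \<le> 0" for \<omega>
      proof -
        have "(\<Sum>i<n. X i \<omega> - m) \<le> 0"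
          using that mult_nonneg_nonneg[OF of_nat_0_le_iff mean(2), of n]
          by (simp add: sum_subtractf)
        then show ?thesis
          unfolding S_def using var(2) by (intro divide_nonpos_nonneg) auto
      qed
      then show "prob {\<omega> \<in> space M. (\<Sum>i<n. X i \<omega>) \<le> 0} \<le> cdf (distr M borel (S n)) 0"
        unfolding cdf_def by (subst measure_distr) (auto intro!: finite_measure_mono)
    qed
    show "\<forall>\<^sub>F n in sequentially. cdf (distr M borel (S n)) 0 \<le> 1"
      unfolding cdf_def by (auto simp: measure_distr)
  qed simp
  ultimately have "cdf std_normal_distribution 0 = 1"
    by (rule LIMSEQ_unique)
  then show False
    using cdf_std_normal_0_less_1 by simp
qed

text \<open>The \<open>s\<close>-th moments of the partial products form a convergent geometric series. Hence the sum of
  their \<open>s\<close>-th powers has finite expectation and is almost surely finite, and its terms tend to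
  \<open>0\<close>.\<close>

lemma (in prob_space) prod_tendsto_0_if_moment_less_1:
  fixes Y :: "nat \<Rightarrow> 'a \<Rightarrow> real"
  assumes indep: "indep_vars (\<lambda>_. borel) Y UNIV"
    and nonneg: "\<And>i \<omega>. 0 \<le> Y i \<omega>"
    and s: "0 < s"
    and int: "\<And>i. integrable M (\<lambda>\<omega>. Y i \<omega> powr s)"
    and mom: "\<And>i. expectation (\<lambda>\<omega>. Y i \<omega> powr s) = \<rho>" "\<rho> < 1"
  shows "AE \<omega> in M. (\<lambda>n. \<Prod>i<n. Y i \<omega>) \<longlonglongrightarrow> 0"
proof -
  have [measurable]: "random_variable borel (Y n)" for n
    using indep unfolding indep_vars_def2 by simp
  define Z where "Z = (\<lambda>n \<omega>. \<Prod>i<n. Y i \<omega> powr s)"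
  have Z: "Z n \<omega> = (\<Prod>i<n. Y i \<omega>) powr s" for n \<omega>
    unfolding Z_def by (simp add: nonneg prod_powr_distrib)
  have Znn: "0 \<le> Z n \<omega>" for n \<omega>
    unfolding Z by simp
  have [measurable]: "Z n \<in> borel_measurable M" for n
    unfolding Z_def by measurable
  have \<rho>: "0 \<le> \<rho>"
    unfolding mom(1)[of 0, symmetric] by simp
  have indep': "indep_vars (\<lambda>_. borel) (\<lambda>i \<omega>. Y i \<omega> powr s) {..<n}" for n
    by (rule indep_vars_subset[OF indep_vars_compose2[OF indep]]) auto
  have EZ: "integral\<^sup>N M (Z n) = ennreal (\<rho> ^ n)" for n
  proof (subst nn_integral_eq_integral)
    show "integrable M (Z n)"
      unfolding Z_def by (intro indep_vars_integrable indep' int) auto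
    have "expectation (Z n) = (\<Prod>i<n. expectation (\<lambda>\<omega>. Y i \<omega> powr s))"
      unfolding Z_def by (intro indep_vars_lebesgue_integral indep' int) auto
    then show "ennreal (expectation (Z n)) = ennreal (\<rho> ^ n)"
      by (simp add: mom)
  qed (use Znn in auto)
  have "(\<integral>\<^sup>+\<omega>. (\<Sum>n. ennreal (Z n \<omega>)) \<partial>M) = (\<Sum>n. ennreal (\<rho> ^ n))"
    by (subst nn_integral_suminf) (auto simp: EZ)
  also have "\<dots> = ennreal (\<Sum>n. \<rho> ^ n)"
    using \<rho> mom(2) by (intro suminf_ennreal2 summable_geometric) auto
  finally have "AE \<omega> in M. (\<Sum>n. ennreal (Z n \<omega>)) \<noteq> \<infinity>"
    by (intro nn_integral_PInf_AE) auto
  then show ?thesis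
  proof eventually_elim
    case (elim \<omega>)
    then have "summable (\<lambda>n. Z n \<omega>)"
      using Znn by (intro summable_suminf_not_top) auto
    then have "(\<lambda>n. Z n \<omega>) \<longlonglongrightarrow> 0"
      by (rule summable_LIMSEQ_zero)
    then have "(\<lambda>n. Z n \<omega> powr (1 / s)) \<longlonglongrightarrow> 0"
      using Znn s by (intro tendsto_zero_powrI[OF _ tendsto_const]) auto
    moreover have "Z n \<omega> powr (1 / s) = (\<Prod>i<n. Y i \<omega>)" for n
      unfolding Z using s by (simp add: powr_powr prod_nonneg nonneg)
    ultimately show ?case by simp
  qed
qed

section \<open>The region of asymptotic stability\<close>

text \<open>If the variance vanished, the squared modulus of the factor would be constant for almost all
  \<open>t\<close>, but it is a polynomial in \<open>t\<close> of degree \<open>2\<close>.\<close>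

lemma variance_ln_rk_factor_pos:
  assumes "z \<noteq> 0"
  shows "0 < unif01.variance (\<lambda>t. ln (cmod (rk_factor t z)))"
proof (rule ccontr)
  let ?L = "\<lambda>t. ln (cmod (rk_factor t z))"
  let ?m = "unif01.expectation ?L"
  assume "\<not> ?thesis"
  then have "unif01.variance ?L = 0"
    using unif01.variance_positive[of ?L] by linarith
  moreover have "integrable unif01 (\<lambda>t. (?L t - ?m)\<^sup>2)"
    unfolding power2_diff using integrable_ln_rk_factor_square integrable_ln_rk_factor by simp
  ultimately have const: "AE t in unif01. (?L t - ?m)\<^sup>2 = 0"
    by (subst (asm) integral_nonneg_eq_0_iff_AE) auto
  define Q where "Q = [:1 + 2 * Re z + (cmod z)\<^sup>2 - exp (2 * ?m),
    2 * (2 * (Re z)\<^sup>2 + (Re z - 1) * (cmod z)\<^sup>2), (cmod z) ^ 4:]"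
  have root: "poly Q t = 0" if "(?L t - ?m)\<^sup>2 = 0" "rk_factor t z \<noteq> 0" for t
  proof -
    have "?L t = ?m" using that(1) by simp
    moreover have "cmod (rk_factor t z) = exp (?L t)" using that(2) by simp
    ultimately have "(cmod (rk_factor t z))\<^sup>2 = exp (2 * ?m)"
      by (simp only: exp_double)
    then show ?thesis
      unfolding cmod_rk_factor_square by (simp add: Q_def power2_eq_square algebra_simps)
  qed
  have "finite {t. poly Q t = 0}"
    using assms by (intro poly_roots_finite) (simp add: Q_def)
  from AE_unif01_notin_finite[OF this] have "AE t in unif01. poly Q t \<noteq> 0"
    by simp
  with const have "AE t in unif01. False"
    using AE_rk_factor_nonzero[of z] by eventually_elim (use root in blast)
  then show False by simp
qed

text \<open>A negative mean logarithm makes a moment of the factors small, so the products vanish in the limit;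
  a nonnegative one makes their logarithms a random walk that cannot stay below \<open>0\<close>. The latter
  argument needs steps of positive variance and therefore leaves out \<open>z = 0\<close>, where \<open>V\<^sup>k = \<eta>\<close>.\<close>

lemma region_AS_eq_mean_log_factor_neg:
  fixes M :: "'a measure" and \<tau> :: "nat \<Rightarrow> 'a \<Rightarrow> real" and \<eta> :: complex
  assumes M: "prob_space M"
    and indep: "prob_space.indep_vars M (\<lambda>_. borel) \<tau> {1..}"
    and law: "\<And>j. j \<ge> 1 \<Longrightarrow> distr M borel (\<tau> j) = unif01"
    and \<eta>: "\<eta> \<noteq> 0"
  shows "region_AS M \<eta> \<tau> = {z. mean_log_factor z < 0}"
proof -
  interpret prob_space M by (rule M)
  have "Suc ` UNIV = {1..}"
    by (auto simp: image_iff Suc_le_eq gr0_conv_Suc)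
  then have indepS: "indep_vars (\<lambda>_. borel) (\<lambda>i. \<tau> (Suc i)) UNIV"
    using indep indep_vars_reindex[of Suc UNIV "\<lambda>_. borel" \<tau>] by simp
  then have [measurable]: "random_variable borel (\<tau> (Suc i))" for i
    unfolding indep_vars_def2 by simp
  have lawS: "distr M borel (\<tau> (Suc i)) = unif01" for i
    using law[of "Suc i"] by simp
  have expect: "expectation (\<lambda>\<omega>. g (\<tau> (Suc i) \<omega>)) = integral\<^sup>L unif01 g"
    if "g \<in> borel_measurable borel" for g :: "real \<Rightarrow> real" and i
    unfolding lawS[of i, symmetric] using that by (subst integral_distr) auto
  have integrable: "integrable M (\<lambda>\<omega>. g (\<tau> (Suc i) \<omega>))"
    if "g \<in> borel_measurable borel" "integrable unif01 g" for g :: "real \<Rightarrow> real" and i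
    using that(2) unfolding lawS[of i, symmetric] by (subst (asm) integrable_distr_eq) (use that(1) in auto)
  have norm_step: "norm (rk_step \<eta> \<tau> z k \<omega>) = cmod \<eta> * (\<Prod>i<k. cmod (rk_factor (\<tau> (Suc i) \<omega>) z))" for z k \<omega>
    by (simp add: rk_step_def norm_mult prod_norm prod.atLeast1_atMost_eq)
  have conv_iff: "(\<lambda>k. rk_step \<eta> \<tau> z k \<omega>) \<longlonglongrightarrow> 0 \<longleftrightarrow>
      (\<lambda>k. \<Prod>i<k. cmod (rk_factor (\<tau> (Suc i) \<omega>) z)) \<longlonglongrightarrow> 0" for z \<omega>
    using \<eta> tendsto_mult_left_iff[of "cmod \<eta>" _ 0]
    by (subst tendsto_norm_zero_iff[symmetric]) (simp add: norm_step)
  have "z \<in> region_AS M \<eta> \<tau>" if neg: "mean_log_factor z < 0" for z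
  proof -
    obtain s where s: "0 < s" "(\<integral>t. cmod (rk_factor t z) powr s \<partial>unif01) < 1"
      using neg unfolding mean_log_factor_neg_iff_moment by blast
    have "AE \<omega> in M. (\<lambda>k. \<Prod>i<k. cmod (rk_factor (\<tau> (Suc i) \<omega>) z)) \<longlonglongrightarrow> 0"
    proof (rule prod_tendsto_0_if_moment_less_1[OF _ _ s(1) _ _ s(2)])
      show "indep_vars (\<lambda>_. borel) (\<lambda>i \<omega>. cmod (rk_factor (\<tau> (Suc i) \<omega>) z)) UNIV"
        by (rule indep_vars_compose2[OF indepS]) measurable
      show "integrable M (\<lambda>\<omega>. cmod (rk_factor (\<tau> (Suc i) \<omega>) z) powr s)" for i
        by (rule integrable[OF _ integrable_rk_factor_powr(1)[OF s(1)]]) measurable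
      show "expectation (\<lambda>\<omega>. cmod (rk_factor (\<tau> (Suc i) \<omega>) z) powr s)
          = (\<integral>t. cmod (rk_factor t z) powr s \<partial>unif01)" for i
        by (rule expect) measurable
    qed simp
    then show ?thesis
      by (simp add: region_AS_def conv_iff)
  qed
  moreover have "z \<notin> region_AS M \<eta> \<tau>" if nonneg: "0 \<le> mean_log_factor z" for z
  proof
    let ?L = "\<lambda>t. ln (cmod (rk_factor t z))"
    assume "z \<in> region_AS M \<eta> \<tau>"
    then have conv: "AE \<omega> in M. (\<lambda>k. \<Prod>i<k. cmod (rk_factor (\<tau> (Suc i) \<omega>) z)) \<longlonglongrightarrow> 0"
      by (simp add: region_AS_def conv_iff)
    have "z \<noteq> 0"
    proof
      assume "z = 0"
      then show False
        using conv by (simp add: LIMSEQ_const_iff)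
    qed
    have "\<not> (AE \<omega> in M. \<forall>\<^sub>F n in sequentially. (\<Sum>i<n. ?L (\<tau> (Suc i) \<omega>)) \<le> 0)"
    proof (rule random_walk_not_AE_eventually_nonpos[OF _ _ nonneg _ _ variance_ln_rk_factor_pos[OF \<open>z \<noteq> 0\<close>]])
      show "indep_vars (\<lambda>_. borel) (\<lambda>i \<omega>. ?L (\<tau> (Suc i) \<omega>)) UNIV"
        by (rule indep_vars_compose2[OF indepS]) measurable
      show mean: "expectation (\<lambda>\<omega>. ?L (\<tau> (Suc i) \<omega>)) = mean_log_factor z" for i
        unfolding mean_log_factor_def by (rule expect) measurable
      show "integrable M (\<lambda>\<omega>. (?L (\<tau> (Suc i) \<omega>))\<^sup>2)" for i
        by (rule integrable[OF _ integrable_ln_rk_factor_square]) measurable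
      show "variance (\<lambda>\<omega>. ?L (\<tau> (Suc i) \<omega>)) = unif01.variance ?L" for i
        unfolding mean unfolding mean_log_factor_def by (rule expect) measurable
      show "distr M borel (\<lambda>\<omega>. ?L (\<tau> (Suc i) \<omega>)) = distr unif01 borel ?L" for i
        unfolding lawS[of i, symmetric] by (subst distr_distr) (auto simp: comp_def)
    qed
    moreover have "AE \<omega> in M. \<forall>\<^sub>F n in sequentially. (\<Sum>i<n. ?L (\<tau> (Suc i) \<omega>)) \<le> 0"
    proof -
      \<comment> \<open>Only without vanishing factors is the logarithm of the product the sum of logarithms.\<close>
      have "AE \<omega> in M. rk_factor (\<tau> (Suc i) \<omega>) z \<noteq> 0" for i
        using AE_rk_factor_nonzero[of z] unfolding lawS[of i, symmetric]
        by (subst (asm) AE_distr_iff) auto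
      then have "AE \<omega> in M. \<forall>i. rk_factor (\<tau> (Suc i) \<omega>) z \<noteq> 0"
        unfolding AE_all_countable by blast
      with conv show ?thesis
      proof eventually_elim
        case (elim \<omega>)
        from order_tendstoD(2)[OF elim(1), of 1]
        have "\<forall>\<^sub>F n in sequentially. (\<Prod>i<n. cmod (rk_factor (\<tau> (Suc i) \<omega>) z)) < 1"
          by simp
        then show ?case
        proof eventually_elim
          case less: (elim n)
          have "(\<Sum>i<n. ?L (\<tau> (Suc i) \<omega>)) = ln (\<Prod>i<n. cmod (rk_factor (\<tau> (Suc i) \<omega>) z))"
            using elim(2) by (subst ln_prod) auto
          also have "\<dots> \<le> 0"
            using less elim(2) by (subst ln_le_zero_iff) (auto intro!: prod_pos)
          finally show ?case .
        qed
      qed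
    qed
    ultimately show False by blast
  qed
  ultimately show ?thesis
    by (intro set_eqI) (metis mem_Collect_eq not_less)
qed

lemma interval_Mid_subset: "interval_Mid \<subseteq> complex_of_real ` {-2..<0}"
proof
  fix z assume "z \<in> interval_Mid"
  then have "Im z = 0" and mid: "(cmod (1 / 2 * z\<^sup>2 + z + 1))\<^sup>2 < 1"
    by (auto simp: interval_Mid_def region_Mid_def)
  then obtain x where z: "z = of_real x"
    by (metis complex_is_Real_iff Reals_cases)
  have "1 / 2 * z\<^sup>2 + z + 1 = of_real (1 / 2 * x\<^sup>2 + x + 1)"
    by (simp add: z)
  with mid have "(1 / 2 * x\<^sup>2 + x + 1)\<^sup>2 < 1"
    by (simp only: norm_of_real power2_abs)
  then have "1 / 2 * x\<^sup>2 + x + 1 < 1"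
    by (simp add: abs_square_less_1)
  then have "x * (x + 2) < 0"
    by (simp add: power2_eq_square algebra_simps)
  then have "-2 < x \<and> x < 0"
    by (auto simp: mult_less_0_iff)
  then show "z \<in> complex_of_real ` {-2..<0}"
    by (auto simp: z)
qed

theorem theorem4:
  fixes M :: "'a measure" and \<tau> :: "nat \<Rightarrow> 'a \<Rightarrow> real" and \<eta> :: complex
  assumes "prob_space M"
    and "complete_measure M"
    and "prob_space.indep_vars M (\<lambda>_. borel) \<tau> {1..}"
    and "\<And>j. j \<ge> 1 \<Longrightarrow> distr M borel (\<tau> j) = uniform_measure lborel {0..1}"
    and "\<eta> \<noteq> 0"
  shows "(open (region_AS M \<eta> \<tau>) \<and> cnj ` region_AS M \<eta> \<tau> = region_AS M \<eta> \<tau>)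
    \<and> (interval_Mid \<subseteq> complex_of_real ` {-2..<0}
        \<and> complex_of_real ` {-2..<0} \<subseteq> interval_AS M \<eta> \<tau>
        \<and> interval_AS M \<eta> \<tau> \<subseteq> complex_of_real ` {- sqrt (2 * exp 1)<..<0})
    \<and> (\<exists>r0::real. 0 < r0 \<and>
          region_AS M \<eta> \<tau> \<subseteq> {z. Re z < 0} \<inter> {z. cmod z < r0})"
proof -
  have region: "region_AS M \<eta> \<tau> = {z. mean_log_factor z < 0}"
    using assms(1,3,4,5) by (rule region_AS_eq_mean_log_factor_neg)
  have bounded: "region_AS M \<eta> \<tau> \<subseteq> {z. Re z < 0} \<inter> {z. cmod z < sqrt (2 * exp 1)}"
    unfolding region using mean_log_factor_nonneg_Re mean_log_factor_nonneg_large
    by (force simp: not_less[symmetric])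
  have "open (region_AS M \<eta> \<tau>)"
    unfolding region by (rule open_mean_log_factor_neg)
  moreover have "cnj ` region_AS M \<eta> \<tau> = region_AS M \<eta> \<tau>"
  proof -
    have "cnj ` region_AS M \<eta> \<tau> \<subseteq> region_AS M \<eta> \<tau>"
      by (auto simp: region mean_log_factor_cnj)
    moreover from image_mono[OF this, of cnj] have "region_AS M \<eta> \<tau> \<subseteq> cnj ` region_AS M \<eta> \<tau>"
      by (simp add: image_image)
    ultimately show ?thesis by blast
  qed
  moreover have "complex_of_real ` {-2..<0} \<subseteq> interval_AS M \<eta> \<tau>"
  proof -
    have "mean_log_factor (of_real x) < 0" if "x \<in> {-2..<0}" for x
      using that mean_log_factor_neg_Jensen[of x] mean_log_factor_neg_closed_form[of x]
      by (cases "x < -1") auto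
    then show ?thesis
      by (auto simp: interval_AS_def region)
  qed
  moreover have "interval_AS M \<eta> \<tau> \<subseteq> complex_of_real ` {- sqrt (2 * exp 1)<..<0}"
  proof
    fix z assume z: "z \<in> interval_AS M \<eta> \<tau>"
    then have "z = of_real (Re z)"
      by (simp add: interval_AS_def complex_eq_iff)
    moreover have "Re z < 0" "cmod z < sqrt (2 * exp 1)"
      using z bounded by (auto simp: interval_AS_def)
    moreover have "- Re z \<le> cmod z"
      using abs_Re_le_cmod[of z] by linarith
    ultimately show "z \<in> complex_of_real ` {- sqrt (2 * exp 1)<..<0}"
      by (intro image_eqI[of _ _ "Re z"]) auto
  qed
  moreover have "\<exists>r0::real. 0 < r0 \<and> region_AS M \<eta> \<tau> \<subseteq> {z. Re z < 0} \<inter> {z. cmod z < r0}"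
    using bounded by (intro exI[of _ "sqrt (2 * exp 1)"]) simp
  ultimately show ?thesis
    using interval_Mid_subset by blast
qed

end
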